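(* Let $H$ be a graph with $v_H\ge4$ and minimum degree $\delta_H\ge2$, and let $G$ be a graph. If $W_e$ is a witness graph (produced by the witness set algorithm) for an edge $e\in E[\langle G\rangle_H]$, and $W_e$ has $k\ge v_H$ vertices, then $W_e$ has at least $$\lambda_*(k-v_H)+e_H-1$$ edges.
   Context: All graphs are finite and simple. $v_F,e_F,V[F],E[F]$ denote the number of vertices, number of edges, vertex set and edge set of a graph $F$; $F\subset H$ means $F$ is a (not necessarily induced) subgraph of $H$; unions of graphs are taken on vertex sets and edge sets; $F\setminus e$ is $F$ with the edge $e$ deleted (and all vertices kept). $H$-percolation: set $G_0=G$ and, for $t\ge 1$, let $G_t$ (on the same vertex set as $G$) be obtained from $G_{t-1}$ by adding every edge not in $G_{t-1}$ which, if added to $G_{t-1}$, creates a new copy of $H$. Let $\langle G\rangle_H=\bigcup_t G_t$. Witness set algorithm (WSA): it assigns a witness graph $W_e\subset G$ to each $e\in E[\langle G\rangle_H]$ as follows. For $e\in E[G]$, $W_e$ is the single edge $e$ together with its two endpoints. For $t\ge1$ let $E_t=E[G_t]\setminus E[G_{t-1}]$; for each $e\in E_t$ choose (arbitrarily if not unique) a copy $H_e$ of $H$ completed by the addition of $e$ at time $t$, i.e. $e\in E[H_e]$ and $H_e\setminus e\subset G_{t-1}$, and set $W_e=\bigcup_{f\in E[H_e\setminus e]}W_f$. For a graph $H$ with $v_H\ge4$, $$\lambda_*=\min_{F}\frac{e_H-e_F-1}{v_H-v_F},$$ where the minimum is over all subgraphs $F\subset H$ with $2\le v_F<v_H$. 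*)

theory Defs
  imports Complex_Main
begin

type_synonym 'a graph = "'a set \<times> 'a set set"

abbreviation verts :: "'a graph \<Rightarrow> 'a set" where
  "verts G \<equiv> fst G"

abbreviation edges :: "'a graph \<Rightarrow> 'a set set" where
  "edges G \<equiv> snd G"

definition simple_graph :: "'a graph \<Rightarrow> bool" where
  "simple_graph G \<longleftrightarrow> finite (verts G) \<and> (\<forall>e\<in>edges G. e \<subseteq> verts G \<and> card e = 2)"

abbreviation num_verts :: "'a graph \<Rightarrow> nat" where
  "num_verts G \<equiv> card (verts G)"

abbreviation num_edges :: "'a graph \<Rightarrow> nat" where
  "num_edges G \<equiv> card (edges G)"

definition subgraph :: "'a graph \<Rightarrow> 'a graph \<Rightarrow> bool" where
  "subgraph F G \<longleftrightarrow> verts F \<subseteq> verts G \<and> edges F \<subseteq> edges G"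

definition graph_Union :: "'a graph set \<Rightarrow> 'a graph" where
  "graph_Union \<G> = (\<Union>(verts ` \<G>), \<Union>(edges ` \<G>))"

definition add_edge :: "'a graph \<Rightarrow> 'a set \<Rightarrow> 'a graph" where
  "add_edge G e = (verts G, insert e (edges G))"

definition delete_edge :: "'a graph \<Rightarrow> 'a set \<Rightarrow> 'a graph" where
  "delete_edge G e = (verts G, edges G - {e})"

definition degree :: "'a graph \<Rightarrow> 'a \<Rightarrow> nat" where
  "degree G v = card {e \<in> edges G. v \<in> e}"

text \<open>Meaningful only for finite graphs with at least one vertex.\<close>
definition min_degree :: "'a graph \<Rightarrow> nat" where
  "min_degree G = Min (degree G ` verts G)"

definition is_copy :: "'b graph \<Rightarrow> 'a graph \<Rightarrow> bool" where
  "is_copy H K \<longleftrightarrow> (\<exists>\<phi>. inj_on \<phi> (verts H) \<and> K = (\<phi> ` verts H, (\<lambda>e. \<phi> ` e) ` edges H))"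

definition creates_copy :: "'b graph \<Rightarrow> 'a graph \<Rightarrow> 'a set \<Rightarrow> bool" where
  "creates_copy H G e \<longleftrightarrow> (\<exists>K. is_copy H K \<and> subgraph K (add_edge G e) \<and> \<not> subgraph K G)"

definition percolation_step :: "'b graph \<Rightarrow> 'a graph \<Rightarrow> 'a graph" where
  "percolation_step H G =
     (verts G,
      edges G \<union> {e. e \<subseteq> verts G \<and> card e = 2 \<and> e \<notin> edges G \<and> creates_copy H G e})"

primrec percolation :: "'b graph \<Rightarrow> 'a graph \<Rightarrow> nat \<Rightarrow> 'a graph" where
  "percolation H G 0 = G"
| "percolation H G (Suc t) = percolation_step H (percolation H G t)"

definition percolation_closure :: "'b graph \<Rightarrow> 'a graph \<Rightarrow> 'a graph" where
  "percolation_closure H G = graph_Union (range (percolation H G))"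

text \<open>
  \<open>C\<close> records the arbitrary choices made in one run of the witness set algorithm: \<open>C e\<close> is the
  copy of \<open>H\<close> chosen for the edge \<open>e\<close>. \<open>W\<close> is the resulting assignment of witness graphs. Both are
  unconstrained outside the edges on which the algorithm defines them.
\<close>
definition witness_set_algorithm ::
  "'b graph \<Rightarrow> 'a graph \<Rightarrow> ('a set \<Rightarrow> 'a graph) \<Rightarrow> ('a set \<Rightarrow> 'a graph) \<Rightarrow> bool" where
  "witness_set_algorithm H G C W \<longleftrightarrow>
     (\<forall>e\<in>edges G. W e = (e, {e})) \<and>
     (\<forall>t\<ge>1. \<forall>e\<in>edges (percolation H G t) - edges (percolation H G (t - 1)).
        is_copy H (C e) \<and> e \<in> edges (C e) \<and>
        subgraph (delete_edge (C e) e) (percolation H G (t - 1)) \<and>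
        W e = graph_Union (W ` edges (delete_edge (C e) e)))"

text \<open>
  The minimum is over a finite set, nonempty as soon as \<open>H\<close> has at least three vertices.
\<close>
definition lambda_star :: "'b graph \<Rightarrow> real" where
  "lambda_star H =
     Min {(real (num_edges H) - real (num_edges F) - 1) / (real (num_verts H) - real (num_verts F)) | F.
            simple_graph F \<and> subgraph F H \<and> 2 \<le> num_verts F \<and> num_verts F < num_verts H}"

end

theory Submission
  imports Defs
begin

text \<open>
  Call an edge of the closure that is not an edge of \<open>G\<close> \<^emph>\<open>red\<close>. The edges of a witness graph
  \<open>W e\<close> are the non-red edges of the copies \<open>C f\<close> of \<open>H\<close>, where \<open>f\<close> runs through the red edges
  that the algorithm consults while it explains \<open>e\<close>. Take these copies one at a time, in the order
  in which their red edges were added by the percolation, and glue two of them whenever they share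
  an edge. What results at each stage is a family of pairwise edge-disjoint \<^emph>\<open>clusters\<close>, and the
  claim is that every cluster with \<open>v\<close> vertices contains at least
  \<open>lambda_star H * (v - v\<^sub>H) + e\<^sub>H - 1\<close> non-red edges.

  A cluster consisting of one copy has \<open>v\<^sub>H\<close> vertices and \<open>e\<^sub>H - 1\<close> non-red edges. Let a later copy
  \<open>C x\<close> share edges with the clusters \<open>K\<^sub>1, \<dots>, K\<^sub>s\<close>, and let \<open>F\<^sub>i\<close> be its intersection with
  \<open>K\<^sub>i\<close>. All red edges of \<open>C x\<close> other than \<open>x\<close> already lie in some \<open>K\<^sub>i\<close>, while \<open>x\<close> itself lies in
  none, so the merged cluster gains \<open>e\<^sub>H - 1 - \<Sum>e(F\<^sub>i)\<close> non-red edges, and at most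
  \<open>v\<^sub>H - \<Sum>v(F\<^sub>i)\<close> vertices. Together with the bounds for the \<open>K\<^sub>i\<close> this is what is needed as soon
  as \<open>e\<^sub>H - 1 - e(F\<^sub>i) \<ge> lambda_star H * (v\<^sub>H - v(F\<^sub>i))\<close> for each \<open>i\<close>. That is the definition of
  \<open>lambda_star\<close> when \<open>F\<^sub>i\<close> misses a vertex, and it holds when \<open>F\<^sub>i\<close> is spanning because \<open>F\<^sub>i\<close> misses
  the edge \<open>x\<close> (lemmas \<open>lambda_star_le_copy\<close> and \<open>dense_merge\<close>). Only an upper bound on the number
  of vertices is available, which suffices because the minimum degree condition makes
  \<open>lambda_star H\<close> nonnegative (lemma \<open>lambda_star_nonneg\<close>).

  At the end the cluster of \<open>C e\<close> has absorbed every copy used for \<open>e\<close>: if a red edge \<open>f\<close> lies in a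
  cluster, then \<open>C f\<close> shares \<open>f\<close> with that cluster. So it contains all vertices of \<open>W e\<close>.
\<close>

section \<open>Graphs and copies\<close>

lemma simple_graph_finite_edges: "simple_graph K \<Longrightarrow> finite (edges K)"
  unfolding simple_graph_def by (rule finite_subset[of _ "Pow (verts K)"]) auto

lemma simple_graph_Union:
  assumes "finite \<G>" "\<And>K. K \<in> \<G> \<Longrightarrow> simple_graph K"
  shows "simple_graph (graph_Union \<G>)"
proof -
  have "finite (\<Union>(verts ` \<G>))"
    using assms by (simp add: simple_graph_def)
  moreover have "d \<subseteq> \<Union>(verts ` \<G>) \<and> card d = 2" if "d \<in> \<Union>(edges ` \<G>)" for d
    using that assms(2) unfolding simple_graph_def by blast
  ultimately show ?thesis
    by (simp add: simple_graph_def graph_Union_def)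
qed

lemma is_copy_simple_graph:
  assumes "simple_graph H" "is_copy H K"
  shows "simple_graph K"
proof -
  obtain \<phi> where \<phi>: "inj_on \<phi> (verts H)" "K = (\<phi> ` verts H, (\<lambda>e. \<phi> ` e) ` edges H)"
    using assms(2) unfolding is_copy_def by blast
  have "card (\<phi> ` d) = 2" if "d \<in> edges H" for d
    using that assms(1) \<phi>(1) unfolding simple_graph_def
    by (metis card_image inj_on_subset)
  then show ?thesis
    using assms(1) \<phi>(2) unfolding simple_graph_def by auto
qed

lemma inj_on_image_edges:
  assumes "simple_graph H" "inj_on \<phi> (verts H)"
  shows "inj_on (\<lambda>e. \<phi> ` e) (edges H)"
  using assms unfolding simple_graph_def inj_on_def[of "\<lambda>e. \<phi> ` e"]
  by (meson inj_on_image_eq_iff)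

lemma is_copy_num_verts: "is_copy H K \<Longrightarrow> num_verts K = num_verts H"
  unfolding is_copy_def by (auto simp: card_image)

lemma is_copy_num_edges:
  "simple_graph H \<Longrightarrow> is_copy H K \<Longrightarrow> num_edges K = num_edges H"
  unfolding is_copy_def by (auto simp: card_image inj_on_image_edges)

section \<open>The density parameter\<close>

lemma finite_subgraphs:
  assumes "simple_graph H"
  shows "finite {F. subgraph F H}"
proof (rule finite_subset)
  show "{F. subgraph F H} \<subseteq> Pow (verts H) \<times> Pow (edges H)"
    unfolding subgraph_def by (auto simp: mem_Times_iff)
  show "finite (Pow (verts H) \<times> Pow (edges H))"
    using assms simple_graph_finite_edges[OF assms] by (auto simp: simple_graph_def)
qed

lemma finite_lambda_star_ratios:
  assumes "simple_graph H"
  shows "finite {(real (num_edges H) - real (num_edges F) - 1) / (real (num_verts H) - real (num_verts F)) | F.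
            simple_graph F \<and> subgraph F H \<and> 2 \<le> num_verts F \<and> num_verts F < num_verts H}"
  by (rule finite_subset[OF _ finite_imageI[OF finite_subgraphs[OF assms]]]) auto

lemma lambda_star_le:
  assumes "simple_graph H" "simple_graph F" "subgraph F H" "2 \<le> num_verts F" "num_verts F < num_verts H"
  shows "lambda_star H * (real (num_verts H) - real (num_verts F))
           \<le> real (num_edges H) - real (num_edges F) - 1"
proof -
  have "lambda_star H \<le> (real (num_edges H) - real (num_edges F) - 1) / (real (num_verts H) - real (num_verts F))"
    unfolding lambda_star_def
    by (rule Min_le[OF finite_lambda_star_ratios[OF assms(1)]]) (use assms in blast)
  then show ?thesis
    using assms(5) by (simp add: field_simps)
qed

text \<open>
  A subgraph on fewer vertices loses all edges at some vertex, hence at least two edges; so every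
  numerator in the definition of \<open>lambda_star\<close> is positive.
\<close>
lemma lambda_star_nonneg:
  assumes H: "simple_graph H" "num_verts H \<ge> 3" "min_degree H \<ge> 2"
  shows "lambda_star H \<ge> 0"
proof -
  define R where "R = {(real (num_edges H) - real (num_edges F) - 1) / (real (num_verts H) - real (num_verts F)) | F.
            simple_graph F \<and> subgraph F H \<and> 2 \<le> num_verts F \<and> num_verts F < num_verts H}"
  have fin: "finite (verts H)" "finite (edges H)"
    using H(1) simple_graph_finite_edges[OF H(1)] by (simp_all add: simple_graph_def)
  have "2 \<le> num_verts H" using H(2) by simp
  then obtain T where T: "T \<subseteq> verts H" "card T = 2"
    by (meson obtain_subset_with_card_n)
  have "simple_graph (T, {})" "subgraph (T, {}) H"
    using T fin finite_subset by (auto simp: simple_graph_def subgraph_def)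
  then have "R \<noteq> {}"
    unfolding R_def using T H(2) by fastforce
  moreover have "finite R"
    unfolding R_def by (rule finite_lambda_star_ratios[OF H(1)])
  moreover have "0 \<le> r" if mem: "r \<in> R" for r
  proof -
    obtain F where F: "subgraph F H" "simple_graph F" "num_verts F < num_verts H"
      and r: "r = (real (num_edges H) - real (num_edges F) - 1) / (real (num_verts H) - real (num_verts F))"
      using mem unfolding R_def by blast
    have "verts F \<subset> verts H"
      using F by (auto simp: subgraph_def)
    then obtain v where v: "v \<in> verts H" "v \<notin> verts F" by blast
    have "2 \<le> degree H v"
    proof -
      have "min_degree H \<le> degree H v"
        unfolding min_degree_def using v(1) fin(1) by (intro Min_le) auto
      with H(3) show ?thesis by (rule order_trans)
    qed
    moreover have "edges F \<subseteq> edges H - {d \<in> edges H. v \<in> d}"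
      using F v unfolding subgraph_def simple_graph_def by blast
    then have "num_edges F \<le> num_edges H - degree H v"
      using fin(2) card_mono[of "edges H - {d \<in> edges H. v \<in> d}" "edges F"]
      by (simp add: degree_def card_Diff_subset)
    moreover have "degree H v \<le> num_edges H"
      unfolding degree_def by (rule card_mono) (use fin in auto)
    ultimately show ?thesis
      using F(3) unfolding r by (intro divide_nonneg_nonneg) auto
  qed
  ultimately show ?thesis
    unfolding lambda_star_def R_def[symmetric] by (simp add: Min_ge_iff)
qed

text \<open>
  The form in which the density parameter is used: inside a copy of \<open>H\<close>, spanning subgraphs are
  admitted too, provided that they omit an edge.
\<close>
lemma lambda_star_le_copy:
  assumes H: "simple_graph H" and K: "is_copy H K"
    and F: "simple_graph F" "subgraph F K" "2 \<le> num_verts F" "edges F \<noteq> edges K"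
  shows "lambda_star H * (real (num_verts H) - real (num_verts F))
           \<le> real (num_edges H) - real (num_edges F) - 1"
proof (cases "num_verts F < num_verts H")
  case True
  obtain \<phi> where \<phi>: "inj_on \<phi> (verts H)" and K_eq: "K = (\<phi> ` verts H, (\<lambda>e. \<phi> ` e) ` edges H)"
    using K unfolding is_copy_def by blast
  define F' where "F' = ({v \<in> verts H. \<phi> v \<in> verts F}, {d \<in> edges H. \<phi> ` d \<in> edges F})"
  have "bij_betw \<phi> (verts F') (verts F)"
    using F(2) inj_on_subset[OF \<phi>, of "verts F'"] unfolding bij_betw_def F'_def subgraph_def K_eq
    by auto
  then have v: "num_verts F' = num_verts F" by (rule bij_betw_same_card)
  have "bij_betw (\<lambda>e. \<phi> ` e) (edges F') (edges F)"
    using F(2) inj_on_subset[OF inj_on_image_edges[OF H \<phi>], of "edges F'"]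
    unfolding bij_betw_def F'_def subgraph_def K_eq by auto
  then have e: "num_edges F' = num_edges F" by (rule bij_betw_same_card)
  have "simple_graph F'" "subgraph F' H"
    using H F(1) unfolding simple_graph_def subgraph_def F'_def by fastforce+
  from lambda_star_le[OF H this] show ?thesis
    using True F(3) unfolding v e by simp
next
  case False
  have simple: "simple_graph K" by (rule is_copy_simple_graph[OF H K])
  have "num_verts F \<le> num_verts H"
    using F(2) simple card_mono[of "verts K" "verts F"] is_copy_num_verts[OF K]
    by (simp add: subgraph_def simple_graph_def)
  moreover have "num_edges F < num_edges H"
    using F(2,4) psubset_card_mono[OF simple_graph_finite_edges[OF simple], of "edges F"]
      is_copy_num_edges[OF H K] by (auto simp: subgraph_def)
  ultimately show ?thesis using False by simp
qed

section \<open>Clusters of copies\<close>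

text \<open>
  The set \<open>B\<close> collects the non-red edges; only these are counted, although the vertex set of \<open>K\<close>
  may be spanned by red edges as well.
\<close>
definition dense :: "'b graph \<Rightarrow> 'a set set \<Rightarrow> 'a graph \<Rightarrow> bool" where
  "dense H B K \<longleftrightarrow>
     lambda_star H * (real (num_verts K) - real (num_verts H)) + real (num_edges H) - 1
       \<le> real (card (edges K \<inter> B))"

text \<open>
  The merging step. The hypotheses say that \<open>x\<close> is the only edge of the new copy \<open>K\<close> that is
  neither in \<open>B\<close> nor in an old cluster, so the merger costs one red edge only. Distinct old clusters
  may share vertices, even outside \<open>K\<close>; such coincidences only lower the number of vertices of the
  union, and hence the required number of edges. With \<open>Q\<close> empty this creates a new cluster.
\<close>
lemma dense_merge:
  assumes H: "simple_graph H" and pos: "lambda_star H \<ge> 0"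
    and K: "is_copy H K" and x: "x \<in> edges K" "\<And>L. L \<in> Q \<Longrightarrow> x \<notin> edges L"
    and Q: "finite Q" "\<And>L. L \<in> Q \<Longrightarrow> simple_graph L" "\<And>L. L \<in> Q \<Longrightarrow> dense H B L"
    and meet: "\<And>L. L \<in> Q \<Longrightarrow> edges L \<inter> edges K \<noteq> {}"
    and disj: "\<And>L L'. L \<in> Q \<Longrightarrow> L' \<in> Q \<Longrightarrow> L \<noteq> L' \<Longrightarrow> edges L \<inter> edges L' = {}"
    and covered: "edges K - {x} \<subseteq> B \<union> \<Union>(edges ` Q)"
  shows "dense H B (graph_Union (insert K Q))"
proof -
  define l n m where "l = lambda_star H" and "n = real (num_verts H)" and "m = real (num_edges H)"
  define M where "M = graph_Union (insert K Q)"
  define A where "A = edges K - {x} - \<Union>(edges ` Q)"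
  define fv fe where "fv L = card (verts L \<inter> verts K)" and "fe L = card (edges L \<inter> edges K)" for L
  have sK: "simple_graph K" by (rule is_copy_simple_graph[OF H K])
  have finV: "finite (verts K)" "\<And>L. L \<in> Q \<Longrightarrow> finite (verts L)"
    using sK Q(2) by (auto simp: simple_graph_def)
  have finE: "finite (edges K)" "\<And>L. L \<in> Q \<Longrightarrow> finite (edges L)"
    using simple_graph_finite_edges[OF sK] simple_graph_finite_edges[OF Q(2)] by simp_all
  have M: "verts M = verts K \<union> \<Union>(verts ` Q)" "edges M = edges K \<union> \<Union>(edges ` Q)"
    by (auto simp: M_def graph_Union_def)

  have intersection: "l * (n - real (fv L)) \<le> m - real (fe L) - 1" if L: "L \<in> Q" for L
  proof -
    define F where "F = (verts L \<inter> verts K, edges L \<inter> edges K)"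
    have F: "simple_graph F" "subgraph F K"
      using sK Q(2)[OF L] by (auto simp: F_def simple_graph_def subgraph_def)
    obtain d where "d \<in> edges F" using meet[OF L] by (auto simp: F_def)
    then have "card d = 2" "d \<subseteq> verts F" using F(1) by (auto simp: simple_graph_def)
    then have "2 \<le> num_verts F"
      using F(1) card_mono[of "verts F" d] by (simp add: simple_graph_def)
    moreover have "edges F \<noteq> edges K"
      using x(1) x(2)[OF L] by (auto simp: F_def)
    ultimately show ?thesis
      using lambda_star_le_copy[OF H K F] by (simp add: F_def fv_def fe_def l_def m_def n_def)
  qed

  have vertex_bound: "real (num_verts M) \<le> n + (\<Sum>L\<in>Q. real (num_verts L) - real (fv L))"
  proof -
    have "verts M = verts K \<union> (\<Union>L\<in>Q. verts L - verts K)"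
      by (auto simp: M)
    then have "num_verts M \<le> num_verts K + card (\<Union>L\<in>Q. verts L - verts K)"
      by (metis card_Un_le)
    also have "\<dots> \<le> num_verts K + (\<Sum>L\<in>Q. card (verts L - verts K))"
      by (intro add_left_mono card_UN_le[OF Q(1)])
    finally have "real (num_verts M) \<le> n + (\<Sum>L\<in>Q. real (card (verts L - verts K)))"
      using is_copy_num_verts[OF K] by (simp add: n_def flip: of_nat_sum)
    also have "(\<Sum>L\<in>Q. real (card (verts L - verts K))) = (\<Sum>L\<in>Q. real (num_verts L) - real (fv L))"
    proof (rule sum.cong[OF refl])
      fix L assume "L \<in> Q"
      then show "real (card (verts L - verts K)) = real (num_verts L) - real (fv L)"
        using finV(2)[of L] card_Int_Diff[of "verts L" "verts K"] by (simp add: fv_def)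
    qed
    finally show ?thesis .
  qed

  have new_edges: "real (card A) = m - 1 - (\<Sum>L\<in>Q. real (fe L))"
  proof -
    have "card (\<Union>L\<in>Q. edges L \<inter> edges K) = (\<Sum>L\<in>Q. fe L)"
      unfolding fe_def by (rule card_UN_disjoint[OF Q(1)]) (use finE disj in blast)+
    moreover have "edges K = insert x (A \<union> (\<Union>L\<in>Q. edges L \<inter> edges K))"
      using x(1) by (auto simp: A_def)
    moreover have "x \<notin> A \<union> (\<Union>L\<in>Q. edges L \<inter> edges K)" "A \<inter> (\<Union>L\<in>Q. edges L \<inter> edges K) = {}"
      using x(2) by (auto simp: A_def)
    moreover have "finite A" "finite (\<Union>L\<in>Q. edges L \<inter> edges K)"
      using finE Q(1) by (auto simp: A_def)
    ultimately have "num_edges K = Suc (card A + (\<Sum>L\<in>Q. fe L))"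
      by (metis card_Un_disjoint card_insert_disjoint finite_UnI)
    then show ?thesis
      using is_copy_num_edges[OF H K] by (simp add: m_def)
  qed

  have edge_bound: "real (card A) + (\<Sum>L\<in>Q. real (card (edges L \<inter> B))) \<le> real (card (edges M \<inter> B))"
  proof -
    have "card (\<Union>L\<in>Q. edges L \<inter> B) = (\<Sum>L\<in>Q. card (edges L \<inter> B))"
      by (rule card_UN_disjoint[OF Q(1)]) (use finE disj in blast)+
    moreover have "card (A \<union> (\<Union>L\<in>Q. edges L \<inter> B)) = card A + card (\<Union>L\<in>Q. edges L \<inter> B)"
      by (rule card_Un_disjoint) (use finE Q(1) in \<open>auto simp: A_def\<close>)
    moreover have "card (A \<union> (\<Union>L\<in>Q. edges L \<inter> B)) \<le> card (edges M \<inter> B)"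
    proof (rule card_mono)
      show "finite (edges M \<inter> B)" using finE Q(1) by (auto simp: M)
      show "A \<union> (\<Union>L\<in>Q. edges L \<inter> B) \<subseteq> edges M \<inter> B"
        using covered by (auto simp: M A_def)
    qed
    ultimately show ?thesis by (simp flip: of_nat_sum of_nat_add)
  qed

  have "l * (real (num_verts M) - n) \<le> l * (\<Sum>L\<in>Q. real (num_verts L) - real (fv L))"
    using vertex_bound pos by (intro mult_left_mono) (auto simp: l_def)
  also have "\<dots> = (\<Sum>L\<in>Q. l * (real (num_verts L) - n) + l * (n - real (fv L)))"
    by (simp add: sum_distrib_left algebra_simps)
  also have "\<dots> \<le> (\<Sum>L\<in>Q. real (card (edges L \<inter> B)) - real (fe L))"
  proof (rule sum_mono)
    fix L assume L: "L \<in> Q"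
    show "l * (real (num_verts L) - n) + l * (n - real (fv L)) \<le> real (card (edges L \<inter> B)) - real (fe L)"
      using intersection[OF L] Q(3)[OF L] by (simp add: dense_def l_def n_def m_def)
  qed
  finally show ?thesis
    using new_edges edge_bound
    by (simp add: dense_def sum_subtractf flip: M_def l_def n_def m_def)
qed

text \<open>
  The state after processing the copies of the red edges in \<open>S\<close>. The inclusion
  \<open>edges K \<subseteq> B \<union> S\<close> keeps a red edge out of every cluster until its own copy is processed.
\<close>
definition dense_clustering ::
  "'b graph \<Rightarrow> ('a set \<Rightarrow> 'a graph) \<Rightarrow> 'a set set \<Rightarrow> 'a set set \<Rightarrow> 'a graph set \<Rightarrow> bool" where
  "dense_clustering H C B S P \<longleftrightarrow> finite P \<and>
    (\<forall>K\<in>P. simple_graph K \<and> dense H B K \<and> edges K \<subseteq> B \<union> S) \<and>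
    (\<forall>K\<in>P. \<forall>L\<in>P. K \<noteq> L \<longrightarrow> edges K \<inter> edges L = {}) \<and>
    (\<forall>f\<in>S. \<exists>K\<in>P. subgraph (C f) K)"

lemma dense_clusteringD:
  assumes "dense_clustering H C B S P"
  shows "finite P"
    and "K \<in> P \<Longrightarrow> simple_graph K" and "K \<in> P \<Longrightarrow> dense H B K" and "K \<in> P \<Longrightarrow> edges K \<subseteq> B \<union> S"
    and "K \<in> P \<Longrightarrow> L \<in> P \<Longrightarrow> K \<noteq> L \<Longrightarrow> edges K \<inter> edges L = {}"
    and "f \<in> S \<Longrightarrow> \<exists>K\<in>P. subgraph (C f) K"
  using assms unfolding dense_clustering_def by simp_all

text \<open>
  The red edges \<open>S\<close> are processed in order of \<open>\<tau>\<close>, the time of their addition. When the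
  turn of a copy comes, all its other red edges have been processed, so each of them lies in a
  cluster.
\<close>
lemma dense_clusters_exist:
  fixes \<tau> :: "'a set \<Rightarrow> nat"
  assumes "finite S" and H: "simple_graph H" and pos: "lambda_star H \<ge> 0"
    and copy: "\<And>f. f \<in> S \<Longrightarrow> is_copy H (C f)" "\<And>f. f \<in> S \<Longrightarrow> f \<in> edges (C f)"
    and B: "B \<inter> S = {}"
    and closed: "\<And>f. f \<in> S \<Longrightarrow> edges (C f) - {f} \<subseteq> B \<union> S"
    and earlier: "\<And>f g. f \<in> S \<Longrightarrow> g \<in> edges (C f) - {f} \<Longrightarrow> \<tau> g < \<tau> f"
  shows "\<exists>P. dense_clustering H C B S P"
  using assms
proof (induction S rule: finite_ranking_induct[where f = \<tau>])
  case empty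
  show ?case by (intro exI[of _ "{}"]) (simp add: dense_clustering_def)
next
  case (insert x S)
  show ?case
  proof (cases "x \<in> S")
    case True
    then have "insert x S = S" by blast
    with insert.IH insert.prems show ?thesis by simp
  next
    case False
    have "edges (C f) - {f} \<subseteq> B \<union> S" if f: "f \<in> S" for f
    proof
      fix g assume g: "g \<in> edges (C f) - {f}"
      then have "\<tau> g < \<tau> x"
        using insert.prems(7)[of f g] insert.hyps(2)[OF f] f by simp
      then have "g \<noteq> x" by blast
      then show "g \<in> B \<union> S" using insert.prems(6)[of f] f g by blast
    qed
    with insert.IH[OF H pos] insert.prems(3-5,7) have "\<exists>P. dense_clustering H C B S P"
      by simp
    then obtain P where "dense_clustering H C B S P" by blast
    note finP = dense_clusteringD(1)[OF this] and P = dense_clusteringD(2-4)[OF this]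
      and disj = dense_clusteringD(5)[OF this] and cover = dense_clusteringD(6)[OF this]
    define Q where "Q = {K \<in> P. edges K \<inter> edges (C x) \<noteq> {}}"
    define M where "M = graph_Union (insert (C x) Q)"
    have QP: "Q \<subseteq> P" and finQ: "finite Q" using finP by (auto simp: Q_def)
    have copy_x: "is_copy H (C x)" and x: "x \<in> edges (C x)"
      using insert.prems(3,4) by auto
    have x_new: "x \<notin> edges K" if "K \<in> P" for K
      using P(3)[OF that] False insert.prems(5) by blast
    have edges_x: "edges (C x) - {x} \<subseteq> B \<union> \<Union>(edges ` Q)"
    proof
      fix g assume g: "g \<in> edges (C x) - {x}"
      then consider "g \<in> B" | "g \<in> S" using insert.prems(6)[of x] by blast
      then show "g \<in> B \<union> \<Union>(edges ` Q)"
      proof cases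
        case 2
        then obtain K where K: "K \<in> P" "subgraph (C g) K" using cover by blast
        then have "g \<in> edges K" using 2 insert.prems(4)[of g] by (auto simp: subgraph_def)
        then have "K \<in> Q" using K(1) g by (auto simp: Q_def)
        then show ?thesis using \<open>g \<in> edges K\<close> by blast
      qed simp
    qed
    have dense_M: "dense H B M"
      unfolding M_def
      by (rule dense_merge[OF H pos copy_x x _ finQ _ _ _ _ edges_x])
        (use QP x_new P disj in \<open>auto simp: Q_def\<close>)
    have simple_M: "simple_graph M"
      unfolding M_def using finQ QP P(1) is_copy_simple_graph[OF H copy_x]
      by (intro simple_graph_Union) auto
    have edges_M: "edges M = edges (C x) \<union> \<Union>(edges ` Q)"
      by (simp add: M_def graph_Union_def)
    have sub_M: "subgraph K M" if "K \<in> insert (C x) Q" for K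
      using that by (auto simp: M_def graph_Union_def subgraph_def)
    have disj_M: "edges K \<inter> edges M = {}" if "K \<in> P - Q" for K
    proof -
      have "edges K \<inter> edges (C x) = {}" using that by (auto simp: Q_def)
      moreover have "edges K \<inter> edges L = {}" if "L \<in> Q" for L
        using disj[of K L] QP that \<open>K \<in> P - Q\<close> by blast
      ultimately show ?thesis by (auto simp: edges_M)
    qed
    have "dense_clustering H C B (insert x S) (insert M (P - Q))"
      unfolding dense_clustering_def
    proof (intro conjI ballI impI)
      show "finite (insert M (P - Q))" using finP by simp
    next
      fix K assume "K \<in> insert M (P - Q)"
      then show "simple_graph K" "dense H B K" using simple_M dense_M P(1,2) by blast+
      have "edges M \<subseteq> B \<union> insert x S"
        unfolding edges_M using insert.prems(6)[of x] QP P(3) by blast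
      then show "edges K \<subseteq> B \<union> insert x S"
        using \<open>K \<in> insert M (P - Q)\<close> P(3) by blast
    next
      fix K L assume "K \<in> insert M (P - Q)" "L \<in> insert M (P - Q)" "K \<noteq> L"
      then show "edges K \<inter> edges L = {}" using disj_M disj by blast
    next
      fix f assume f: "f \<in> insert x S"
      show "\<exists>K\<in>insert M (P - Q). subgraph (C f) K"
      proof (cases "f = x")
        case True
        then show ?thesis using sub_M by blast
      next
        case f_old: False
        then obtain K where K: "K \<in> P" "subgraph (C f) K" using cover f by blast
        show ?thesis
        proof (cases "K \<in> Q")
          case True
          then have "subgraph (C f) M"
            using sub_M[of K] K(2) by (auto simp: subgraph_def)
          then show ?thesis by blast
        qed (use K in blast)
      qed
    qed
    then show ?thesis by blast
  qed
qed

section \<open>Percolation times and witness graphs\<close>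

lemma edges_percolation_closure:
  "edges (percolation_closure H G) = (\<Union>t. edges (percolation H G t))"
  by (simp add: percolation_closure_def graph_Union_def)

lemma verts_percolation [simp]: "verts (percolation H G t) = verts G"
  by (induction t) (simp_all add: percolation_step_def)

lemma simple_graph_percolation:
  "simple_graph G \<Longrightarrow> simple_graph (percolation H G t)"
  by (induction t) (auto simp: percolation_step_def simple_graph_def)

definition birth :: "'b graph \<Rightarrow> 'a graph \<Rightarrow> 'a set \<Rightarrow> nat" where
  "birth H G f = (LEAST t. f \<in> edges (percolation H G t))"

lemma birth_le: "f \<in> edges (percolation H G t) \<Longrightarrow> birth H G f \<le> t"
  unfolding birth_def by (rule Least_le)

lemma red_edge_step:
  assumes "f \<in> edges (percolation_closure H G)" "f \<notin> edges G"
  shows "birth H G f \<ge> 1"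
    and "f \<in> edges (percolation H G (birth H G f)) - edges (percolation H G (birth H G f - 1))"
proof -
  have born: "f \<in> edges (percolation H G (birth H G f))"
    using assms(1) unfolding birth_def edges_percolation_closure by (auto intro: LeastI)
  show pos: "birth H G f \<ge> 1"
    using born assms(2) by (cases "birth H G f") auto
  then show "f \<in> edges (percolation H G (birth H G f)) - edges (percolation H G (birth H G f - 1))"
    using born birth_le[of f H G "birth H G f - 1"] by fastforce
qed

lemma witness_red_edge:
  assumes "witness_set_algorithm H G C W"
    and "f \<in> edges (percolation_closure H G)" "f \<notin> edges G"
  shows "is_copy H (C f)" "f \<in> edges (C f)"
    and "W f = graph_Union (W ` (edges (C f) - {f}))"
    and "\<And>g. g \<in> edges (C f) - {f} \<Longrightarrow> g \<in> edges (percolation_closure H G)"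
    and "\<And>g. g \<in> edges (C f) - {f} \<Longrightarrow> birth H G g < birth H G f"
proof -
  let ?t = "birth H G f"
  note t = red_edge_step[OF assms(2,3)]
  have *: "is_copy H (C f) \<and> f \<in> edges (C f) \<and>
        subgraph (delete_edge (C f) f) (percolation H G (?t - 1)) \<and>
        W f = graph_Union (W ` edges (delete_edge (C f) f))"
    using assms(1) t unfolding witness_set_algorithm_def by blast
  then show "is_copy H (C f)" "f \<in> edges (C f)" "W f = graph_Union (W ` (edges (C f) - {f}))"
    by (auto simp: delete_edge_def)
  fix g assume "g \<in> edges (C f) - {f}"
  then have g: "g \<in> edges (percolation H G (?t - 1))"
    using * by (auto simp: delete_edge_def subgraph_def)
  then show "g \<in> edges (percolation_closure H G)"
    by (auto simp: edges_percolation_closure)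
  show "birth H G g < ?t" using birth_le[OF g] t(1) by simp
qed

lemma witness_base_edge:
  "witness_set_algorithm H G C W \<Longrightarrow> f \<in> edges G \<Longrightarrow> W f = (f, {f})"
  unfolding witness_set_algorithm_def by blast

lemma witness_edges_subset:
  assumes "witness_set_algorithm H G C W" "f \<in> edges (percolation_closure H G)"
  shows "edges (W f) \<subseteq> edges G"
  using assms(2)
proof (induction "birth H G f" arbitrary: f rule: less_induct)
  case less
  show ?case
  proof (cases "f \<in> edges G")
    case True
    then show ?thesis using witness_base_edge[OF assms(1)] by simp
  next
    case False
    note w = witness_red_edge[OF assms(1) less.prems False]
    show ?thesis using less.hyps[OF w(5,4)] unfolding w(3) graph_Union_def by auto
  qed
qed

text \<open>
  Clusters satisfy the hypothesis \<open>absorb\<close>: if the cluster \<open>K\<close> has the red edge \<open>f\<close>, then the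
  cluster containing \<open>C f\<close> has \<open>f\<close> in common with \<open>K\<close>, so by edge-disjointness it is \<open>K\<close>. The
  recursion of the algorithm then never leaves \<open>K\<close>.
\<close>
lemma witness_verts_subset_cluster:
  assumes wsa: "witness_set_algorithm H G C W"
    and K: "simple_graph K"
    and absorb: "\<And>f. f \<in> edges K \<Longrightarrow> f \<notin> edges G \<Longrightarrow> edges (C f) \<subseteq> edges K"
    and f: "f \<in> edges K" "f \<in> edges (percolation_closure H G)"
  shows "verts (W f) \<subseteq> verts K"
  using f
proof (induction "birth H G f" arbitrary: f rule: less_induct)
  case less
  show ?case
  proof (cases "f \<in> edges G")
    case True
    then show ?thesis
      using witness_base_edge[OF wsa] K less.prems(1) by (auto simp: simple_graph_def)
  next
    case False
    note w = witness_red_edge[OF wsa less.prems(2) False]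
    have "verts (W g) \<subseteq> verts K" if "g \<in> edges (C f) - {f}" for g
      using less.hyps[OF w(5)[OF that] _ w(4)[OF that]] absorb[OF less.prems(1) False] that by blast
    then show ?thesis unfolding w(3) graph_Union_def by auto
  qed
qed

section \<open>The edge bound for witness graphs\<close>

theorem proposition9:
  fixes H :: "'b graph" and G :: "'a graph"
    and C W :: "'a set \<Rightarrow> 'a graph" and e :: "'a set" and k :: nat
  assumes "simple_graph H" and "num_verts H \<ge> 4" and "min_degree H \<ge> 2"
    and "simple_graph G"
    and "witness_set_algorithm H G C W"
    and "e \<in> edges (percolation_closure H G)"
    and "num_verts (W e) = k" and "k \<ge> num_verts H"
  shows "real (num_edges (W e)) \<ge>
           lambda_star H * (real k - real (num_verts H)) + real (num_edges H) - 1"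
proof -
  note wsa = assms(5)
  have pos: "lambda_star H \<ge> 0" using lambda_star_nonneg[OF assms(1)] assms(2,3) by simp
  define B where "B = edges (W e)"
  \<comment> \<open>Witness graphs shrink along the recursion of the algorithm, so \<open>S\<close> contains every red edge
     consulted for \<open>e\<close> and is closed under consulting.\<close>
  define S where "S = {f \<in> edges (percolation_closure H G) - edges G. subgraph (W f) (W e)}"
  have red: "e \<notin> edges G"
  proof
    assume "e \<in> edges G"
    then have "k = 2"
      using witness_base_edge[OF wsa] assms(4,7) by (auto simp: simple_graph_def)
    then show False using assms(2,8) by simp
  qed
  then have e: "e \<in> S" using assms(6) by (simp add: S_def subgraph_def)
  have B_G: "B \<subseteq> edges G" unfolding B_def by (rule witness_edges_subset[OF wsa assms(6)])
  have closed: "edges (C f) - {f} \<subseteq> B \<union> S" if f: "f \<in> S" for f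
  proof
    fix g assume g: "g \<in> edges (C f) - {f}"
    note w = witness_red_edge[OF wsa, of f]
    have g_cl: "g \<in> edges (percolation_closure H G)" using w(4)[OF _ _ g] f by (auto simp: S_def)
    have "subgraph (W g) (W f)"
      using w(3) f g by (auto simp: S_def subgraph_def graph_Union_def)
    then have sub: "subgraph (W g) (W e)" using f by (auto simp: S_def subgraph_def)
    show "g \<in> B \<union> S"
    proof (cases "g \<in> edges G")
      case True
      then show ?thesis using sub witness_base_edge[OF wsa True] by (auto simp: B_def subgraph_def)
    next
      case False
      then show ?thesis using sub g_cl by (simp add: S_def)
    qed
  qed
  have "edges (percolation_closure H G) \<subseteq> Pow (verts G)"
  proof
    fix f assume "f \<in> edges (percolation_closure H G)"
    then obtain t where "f \<in> edges (percolation H G t)"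
      by (auto simp: edges_percolation_closure)
    then show "f \<in> Pow (verts G)"
      using simple_graph_percolation[OF assms(4), of H t] by (simp add: simple_graph_def)
  qed
  then have "finite S"
    by (intro finite_subset[of S "Pow (verts G)"])
      (use assms(4) in \<open>auto simp: S_def simple_graph_def\<close>)
  have "\<exists>P. dense_clustering H C B S P"
  proof (rule dense_clusters_exist[OF \<open>finite S\<close> assms(1) pos])
    show "B \<inter> S = {}" using B_G by (auto simp: S_def)
  next
    fix f assume "f \<in> S"
    then have f: "f \<in> edges (percolation_closure H G)" "f \<notin> edges G" by (auto simp: S_def)
    show "is_copy H (C f)" "f \<in> edges (C f)" using witness_red_edge[OF wsa f] by auto
    show "edges (C f) - {f} \<subseteq> B \<union> S" by (rule closed[OF \<open>f \<in> S\<close>])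
    show "birth H G g < birth H G f" if "g \<in> edges (C f) - {f}" for g
      by (rule witness_red_edge(5)[OF wsa f that])
  qed
  then obtain P where "dense_clustering H C B S P" by blast
  note P = dense_clusteringD(2-4)[OF this]
    and disj = dense_clusteringD(5)[OF this] and cover = dense_clusteringD(6)[OF this]
  obtain K where K: "K \<in> P" "subgraph (C e) K" using cover e by blast
  have own: "f \<in> edges (C f)" if "f \<in> S" for f
    using witness_red_edge(2)[OF wsa, of f] that by (simp add: S_def)
  have absorb: "edges (C f) \<subseteq> edges K" if f: "f \<in> edges K" "f \<notin> edges G" for f
  proof -
    have fS: "f \<in> S" using f P(3)[OF K(1)] B_G by blast
    then obtain L where L: "L \<in> P" "subgraph (C f) L" using cover by blast
    then have "f \<in> edges L" using own[OF fS] by (auto simp: subgraph_def)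
    then have "L = K" using disj[OF L(1) K(1)] f(1) by blast
    then show ?thesis using L(2) by (simp add: subgraph_def)
  qed
  have "e \<in> edges K" using own[OF e] K(2) by (auto simp: subgraph_def)
  then have "verts (W e) \<subseteq> verts K"
    using witness_verts_subset_cluster[OF wsa P(1)[OF K(1)] absorb] assms(6) by blast
  then have "real k \<le> real (num_verts K)"
    using P(1)[OF K(1)] assms(7) card_mono by (auto simp: simple_graph_def)
  then have "lambda_star H * (real k - real (num_verts H))
      \<le> lambda_star H * (real (num_verts K) - real (num_verts H))"
    using pos by (intro mult_left_mono) auto
  moreover have "finite B"
    using B_G simple_graph_finite_edges[OF assms(4)] finite_subset by blast
  then have "real (card (edges K \<inter> B)) \<le> real (num_edges (W e))"
    by (simp add: B_def card_mono)
  ultimately show ?thesis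
    using P(2)[OF K(1)] by (simp add: dense_def)
qed

end
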